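(* Let $n,k$ be positive integers with $k\geq 2$, and let $\vec{s}=(s_1,\ldots,s_k)$ be an integer vector with $s_i\geq 2$ for $i\neq k$, $s_k\in\{1,2\}$, and $n\geq \sum_{i=1}^{k-1}s_i+2$. Then $$\chi\left(KG(n,k)_{\vec{s}\text{-stab}}\right)=n-\sum_{i=1}^{k-1}s_i.$$
   Context: $[n]=\{1,\ldots,n\}$. For a $k$-subset $A\subseteq[n]$ let $A(1)<A(2)<\cdots<A(k)$ be its elements in increasing order. Given an integer vector $\vec{s}=(s_1,\ldots,s_k)$, a $k$-subset $A\subseteq[n]$ is called $\vec{s}$-stable if $s_j\leq A(j+1)-A(j)$ for all $1\leq j\leq k-1$ and $A(k)-A(1)\leq n-s_k$. The $\vec{s}$-stable Kneser graph $KG(n,k)_{\vec{s}\text{-stab}}$ is the graph whose vertices are the $\vec{s}$-stable $k$-subsets of $[n]$, two vertices being adjacent iff the corresponding sets are disjoint. $\chi$ denotes the chromatic number. *)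

theory Defs
  imports "HOL-Analysis.Analysis" "Graph_Theory.Pair_Digraph"
begin

text \<open>Indices are 1-based; a vector \<open>(s\<^sub>1, \<dots>, s\<^sub>k)\<close> is a function of which
  only the values at \<open>1, \<dots>, k\<close> matter.\<close>

definition nth_elem :: "nat set \<Rightarrow> nat \<Rightarrow> nat" where
  "nth_elem A j = sorted_list_of_set A ! (j - 1)"

definition stable_set :: "nat \<Rightarrow> nat \<Rightarrow> (nat \<Rightarrow> int) \<Rightarrow> nat set \<Rightarrow> bool" where
  "stable_set n k s A \<longleftrightarrow> A \<subseteq> {1..n} \<and> card A = k \<and>
     (\<forall>j. 1 \<le> j \<and> j \<le> k - 1 \<longrightarrow> s j \<le> int (nth_elem A (j + 1)) - int (nth_elem A j)) \<and>
     int (nth_elem A k) - int (nth_elem A 1) \<le> int n - s k"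

text \<open>An undirected graph is a symmetric loop-free digraph, as in \<^locale>\<open>pair_graph\<close>.\<close>

definition stable_kneser_graph :: "nat \<Rightarrow> nat \<Rightarrow> (nat \<Rightarrow> int) \<Rightarrow> nat set pair_pre_digraph" where
  "stable_kneser_graph n k s =
     \<lparr> pverts = {A. stable_set n k s A},
       parcs = {(A, B). stable_set n k s A \<and> stable_set n k s B \<and> A \<inter> B = {}} \<rparr>"

definition proper_coloring :: "'a pair_pre_digraph \<Rightarrow> nat \<Rightarrow> ('a \<Rightarrow> nat) \<Rightarrow> bool" where
  "proper_coloring G c f \<longleftrightarrow>
     (\<forall>v \<in> pverts G. f v < c) \<and> (\<forall>(u, v) \<in> parcs G. f u \<noteq> f v)"

definition chromatic_number :: "'a pair_pre_digraph \<Rightarrow> nat" where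
  "chromatic_number G = (LEAST c. \<exists>f. proper_coloring G c f)"

lemma pair_graph_stable_kneser_graph:
  assumes "k \<ge> 1"
  shows "pair_graph (stable_kneser_graph n k s)"
proof -
  have fin: "finite {A. stable_set n k s A}"
    by (rule finite_subset[of _ "Pow {1..n}"]) (auto simp: stable_set_def)
  have "finite {(A, B). stable_set n k s A \<and> stable_set n k s B \<and> A \<inter> B = {}}"
    by (rule finite_subset[OF _ finite_cartesian_product[OF fin fin]]) auto
  moreover have "\<not> stable_set n k s {}"
    using assms by (auto simp: stable_set_def)
  ultimately show ?thesis
    using fin
    by unfold_locales
       (auto simp: stable_kneser_graph_def symmetric_def arcs_ends_def arc_to_ends_def sym_def)
qed

lemma (in pair_graph) proper_coloring_chromatic_number:
  "\<exists>f. proper_coloring G (chromatic_number G) f"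
proof -
  obtain f :: "'a \<Rightarrow> nat" and c where f: "f ` pverts G = {i. i < c}" "inj_on f (pverts G)"
    using finite_imp_inj_to_nat_seg[OF pair_finite_verts] by metis
  have "f u \<noteq> f v" if "(u, v) \<in> parcs G" for u v
    using that f(2) in_arcsD1[OF that] in_arcsD2[OF that] pair_no_loops[OF that]
    by (auto dest: inj_onD)
  moreover have "f v < c" if "v \<in> pverts G" for v
    using that f(1) by auto
  ultimately have "proper_coloring G c f"
    by (auto simp: proper_coloring_def)
  then show ?thesis
    unfolding chromatic_number_def by (intro LeastI[of "\<lambda>c. \<exists>f. proper_coloring G c f"] exI)
qed

end

theory Submission
  imports Defs "HOL-Library.Z2" "HOL-Library.Sublist"
begin

text \<open>Write \<open>m = n - (s\<^sub>1 + \<dots> + s\<^bsub>k-1\<^esub>)\<close>. Colouring \<open>A\<close> by \<open>A(1)\<close> uses \<open>m\<close> colours. For the lower bound,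
  consider the box complex: its simplices are the finite sets of signed stable sets in which every
  positive set is disjoint from every negative one. A proper colouring with \<open>c\<close> colours
  labels the vertices by \<open>+1, -1, \<dots>, +c, -c\<close> without complementary edges. As in Fan's lemma, the
  simplices whose labels, sorted by absolute value, alternate in sign starting with \<open>+\<close> form a
  cochain \<open>a\<close> modulo 2 with \<open>\<delta>a = a + \<nu>a\<close>, where \<open>\<nu>\<close> is the antipodal action, and \<open>a\<close> vanishes on
  simplices with more than \<open>c\<close> vertices. If \<open>c < m\<close>, this is impossible by induction on \<open>m\<close>: the top
  nonzero part of \<open>a\<close> is a cocycle, the inclusion of the complex for \<open>n\<close> into the complex for \<open>n + 1\<close> is
  null-homotopic, hence this part becomes a coboundary \<open>\<delta>\<beta>\<close> on the smaller complex, and adding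
  \<open>\<beta> + \<nu>\<beta>\<close> to \<open>a\<close> removes it.\<close>

section \<open>Cochains modulo 2\<close>

text \<open>This simp rule turns sums of bits into \<open>xor\<close>, out of reach of the rules for rings.\<close>

declare add_bit_eq_xor [simp del]

lemma bit_add_self [simp]: "(x::bit) + x = 0"
  by (cases x) auto

lemma bit_add_self_left [simp]: "(x::bit) + (x + y) = y"
  by (simp flip: add.assoc)

lemma bit_add_eq_0: "(x::bit) + y = 0 \<longleftrightarrow> x = y"
  by (cases x; cases y) auto

text \<open>The augmented simplicial coboundary: one summand for each deleted entry, without signs
  modulo 2. Splitting off the head makes inductions vary the cochain.\<close>

fun coboundary :: "('v list \<Rightarrow> bit) \<Rightarrow> 'v list \<Rightarrow> bit" where
  "coboundary a [] = 0"
| "coboundary a (x # xs) = a xs + coboundary (\<lambda>ys. a (x # ys)) xs"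

text \<open>Dual of the prism operator: the switch from \<open>f\<close> to \<open>g\<close> happens
  at each position in turn, and both images of that entry are listed.\<close>

fun prism :: "('v \<Rightarrow> 'w) \<Rightarrow> ('v \<Rightarrow> 'w) \<Rightarrow> ('w list \<Rightarrow> bit) \<Rightarrow> 'v list \<Rightarrow> bit" where
  "prism f g a [] = 0"
| "prism f g a (x # xs) = a (f x # g x # map g xs) + prism f g (\<lambda>ys. a (f x # ys)) xs"

lemma coboundary_cong:
  assumes "\<And>ys. subseq ys xs \<Longrightarrow> length xs = Suc (length ys) \<Longrightarrow> a ys = a' ys"
  shows "coboundary a xs = coboundary a' xs"
  using assms
proof (induction xs arbitrary: a a')
  case (Cons x xs)
  have "a xs = a' xs"
    by (rule Cons.prems) auto
  moreover have "coboundary (\<lambda>ys. a (x # ys)) xs = coboundary (\<lambda>ys. a' (x # ys)) xs"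
    by (rule Cons.IH, rule Cons.prems) auto
  ultimately show ?case by simp
qed simp

lemma coboundary_zero [simp]: "coboundary (\<lambda>_. 0) xs = 0"
  by (induction xs) auto

lemma coboundary_add: "coboundary (\<lambda>ys. a ys + b ys) xs = coboundary a xs + coboundary b xs"
  by (induction xs arbitrary: a b) (auto simp: algebra_simps)

lemma coboundary_map: "coboundary (\<lambda>ys. a (map f ys)) xs = coboundary a (map f xs)"
proof (induction xs arbitrary: a)
  case (Cons x xs)
  show ?case using Cons[of "\<lambda>ys. a (f x # ys)"] by simp
qed simp

lemma prism_add: "prism f g (\<lambda>ys. a ys + b ys) xs = prism f g a xs + prism f g b xs"
  by (induction xs arbitrary: a b) (auto simp: algebra_simps)

lemma prism_eq_0:
  assumes "\<And>ys. set ys \<subseteq> f ` set xs \<union> g ` set xs \<Longrightarrow> length ys = Suc (length xs) \<Longrightarrow> a ys = 0"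
  shows "prism f g a xs = 0"
  using assms
proof (induction xs arbitrary: a)
  case (Cons x xs)
  have "a (f x # g x # map g xs) = 0"
    by (rule Cons.prems) auto
  moreover have "prism f g (\<lambda>ys. a (f x # ys)) xs = 0"
    by (rule Cons.IH, rule Cons.prems) auto
  ultimately show ?case by simp
qed simp

text \<open>Interior faces of the prism cancel in pairs modulo 2; only its two ends remain.\<close>

lemma prism_homotopy:
  "prism f g (coboundary a) xs + coboundary (prism f g a) xs = a (map f xs) + a (map g xs)"
proof (induction xs arbitrary: a)
  case (Cons x xs)
  let ?a1 = "\<lambda>ys. a (f x # ys)" and ?a2 = "\<lambda>ys. a (f x # g x # ys)"
  have 1: "prism f g (coboundary a) (x # xs) =
      a (g x # map g xs) + (a (f x # map g xs) + coboundary ?a2 (map g xs))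
      + (prism f g a xs + prism f g (coboundary ?a1) xs)"
    by (simp add: prism_add)
  have 2: "coboundary (prism f g a) (x # xs) =
      prism f g a xs + (coboundary ?a2 (map g xs) + coboundary (prism f g ?a1) xs)"
    by (simp add: coboundary_add coboundary_map[of ?a2])
  have 3: "coboundary (prism f g ?a1) xs = prism f g (coboundary ?a1) xs
      + (a (f x # map f xs) + a (f x # map g xs))"
    by (simp flip: Cons.IH[of ?a1])
  show ?case
    unfolding 1 2 3 by (simp add: ac_simps)
qed simp

text \<open>The complexes \<open>X\<close> and \<open>Y\<close> are given by the vertex sets of their simplices. Cochains live on all
  lists with such a vertex set, repetitions allowed.\<close>

lemma contiguous_cohomologous:
  assumes contig: "\<And>\<sigma>. \<sigma> \<in> X \<Longrightarrow> f ` \<sigma> \<union> g ` \<sigma> \<in> Y"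
    and down: "\<And>\<sigma> \<tau>. \<sigma> \<in> Y \<Longrightarrow> \<tau> \<subseteq> \<sigma> \<Longrightarrow> \<tau> \<in> Y"
    and cocycle: "\<And>xs. set xs \<in> Y \<Longrightarrow> length xs = Suc d \<Longrightarrow> coboundary a xs = 0"
  shows "\<exists>\<beta>. \<forall>xs. set xs \<in> X \<longrightarrow> length xs = d \<longrightarrow>
           a (map f xs) + a (map g xs) = coboundary \<beta> xs"
proof (intro exI allI impI)
  fix xs assume "set xs \<in> X" "length xs = d"
  \<comment> \<open>\<open>prism\<close> evaluates only lists of length \<open>Suc d\<close> with
    entries in the two images, where \<open>a\<close> is a cocycle.\<close>
  then have "prism f g (coboundary a) xs = 0"
    using down[OF contig] by (intro prism_eq_0 cocycle) auto
  then show "a (map f xs) + a (map g xs) = coboundary (prism f g a) xs"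
    using prism_homotopy[of f g a xs] by simp
qed

section \<open>Alternating simplices\<close>

fun alternates :: "bool \<Rightarrow> nat list \<Rightarrow> bool" where
  "alternates q [] = True"
| "alternates q (x # xs) \<longleftrightarrow> odd x = q \<and> alternates (\<not> q) xs"

text \<open>If a deletion makes a non-alternating list alternate, exactly one pair of neighbours has
  equal parity, and deleting either one gives the same pattern, so the terms cancel. A nonempty
  alternating list leaves one term: the last entry is deleted if it starts with the sign
  \<open>q\<close>, otherwise the first.\<close>

lemma coboundary_alternates:
  "coboundary (\<lambda>ys. of_bool (alternates q ys)) xs =
     of_bool (alternates q xs) + of_bool (alternates (\<not> q) xs)"
proof (induction xs arbitrary: q)
  case (Cons x xs)
  then show ?case
    by (cases "odd x = q") (auto simp: Cons ac_simps)
qed simp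

lemma coboundary_mset:
  "coboundary (\<lambda>ys. h (mset ys)) xs = (\<Sum>x\<in>#mset xs. h (mset xs - {#x#}))"
proof (induction xs arbitrary: h)
  case (Cons x xs)
  have "(\<Sum>y\<in>#mset xs. h (add_mset x (mset xs) - {#y#}))
      = (\<Sum>y\<in>#mset xs. h (add_mset x (mset xs - {#y#})))"
    by (intro arg_cong[of _ _ sum_mset] image_mset_cong) (simp add: add_mset_diff_bothsides)
  then show ?case
    using Cons[of "\<lambda>M. h (add_mset x M)"] by simp
qed simp

lemma sorted_subseq: "subseq xs ys \<Longrightarrow> sorted ys \<Longrightarrow> sorted (xs :: 'a::linorder list)"
  by (auto simp: subseq_conv_nths sorted_nths)

text \<open>Both sides are the same sum over the multiset of entries, and sublists of a sorted list
  are already sorted.\<close>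

lemma coboundary_sort:
  fixes xs :: "nat list"
  shows "coboundary (\<lambda>ys. h (sort ys)) xs = coboundary h (sort xs)"
proof -
  let ?h = "\<lambda>M. h (sorted_list_of_multiset M)"
  have "coboundary (\<lambda>ys. h (sort ys)) xs = (\<Sum>x\<in>#mset xs. ?h (mset xs - {#x#}))"
    using coboundary_mset[of ?h xs] by simp
  also have "\<dots> = coboundary (\<lambda>ys. h (sort ys)) (sort xs)"
    using coboundary_mset[of ?h "sort xs"] by simp
  also have "\<dots> = coboundary h (sort xs)"
  proof (rule coboundary_cong)
    fix ys assume "subseq ys (sort xs)"
    then have "sorted ys" by (rule sorted_subseq) simp
    then show "h (sort ys) = h ys" by (simp add: sorted_sort_id)
  qed
  finally show ?thesis .
qed

text \<open>The natural number \<open>2 c + 1\<close> encodes the label \<open>+c\<close> and \<open>2 c\<close> encodes the label \<open>-c\<close>.\<close>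

definition flip :: "nat \<Rightarrow> nat" where
  "flip x = (if even x then x + 1 else x - 1)"

text \<open>Halving forgets the sign, so injectivity forbids a label together with its
  negative.\<close>

definition no_complementary :: "nat set \<Rightarrow> bool" where
  "no_complementary X \<longleftrightarrow> inj_on (\<lambda>x. x div 2) X"

lemma alternates_map_flip: "alternates q (map flip xs) = alternates (\<not> q) xs"
  by (induction xs arbitrary: q) (auto simp: flip_def)

text \<open>Distinct labels differ in absolute value, which alone decides their order; changing all
  signs preserves it.\<close>

lemma flip_mono:
  assumes "no_complementary X" "x \<in> X" "y \<in> X" "x \<le> y"
  shows "flip x \<le> flip y"
proof (cases "x = y")
  case False
  then have "x div 2 < y div 2"
    using assms by (metis div_le_mono inj_onD le_neq_implies_less no_complementary_def)
  then show ?thesis by (auto simp: flip_def)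
qed simp

lemma sort_map_flip:
  assumes "no_complementary (set xs)"
  shows "sort (map flip xs) = map flip (sort xs)"
proof (rule properties_for_sort)
  have "sorted_wrt (\<lambda>x y. flip x \<le> flip y) (sort xs)"
    by (rule sorted_wrt_mono_rel[OF _ sorted_sort]) (auto intro: flip_mono[OF assms])
  then show "sorted (map flip (sort xs))"
    by (simp add: sorted_wrt_map)
qed simp

lemma coboundary_alternates_sort:
  assumes "no_complementary (set xs)"
  shows "coboundary (\<lambda>ys. of_bool (alternates True (sort ys))) xs =
     of_bool (alternates True (sort xs)) + of_bool (alternates True (sort (map flip xs)))"
  using coboundary_sort[of "\<lambda>ys. of_bool (alternates True ys)" xs]
  by (simp add: coboundary_alternates sort_map_flip[OF assms] alternates_map_flip)

lemma strict_sorted_div2_if_alternates: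
  assumes "sorted xs" "no_complementary (set xs)" "alternates q xs"
  shows "sorted_wrt (<) (map (\<lambda>x. x div 2) xs)"
  using assms
proof (induction xs arbitrary: q rule: induct_list012)
  case (3 x y zs)
  have "x \<noteq> y" using 3 by auto
  then have "x div 2 \<noteq> y div 2"
    using 3 by (auto simp: no_complementary_def dest: inj_onD)
  then have "x div 2 < y div 2"
    using 3 by (simp add: div_le_mono le_neq_implies_less)
  moreover have "sorted_wrt (<) (map (\<lambda>x. x div 2) (y # zs))"
    using 3 by (intro "3.IH"(2)[of "\<not> q"]) (auto simp: no_complementary_def)
  ultimately show ?case
    by (auto simp: sorted_wrt2 dest: order.strict_trans)
qed auto

text \<open>The absolute values are distinct numbers below \<open>c\<close>; hence the alternating
  cochain vanishes on longer lists.\<close>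

lemma alternates_length_le:
  assumes "no_complementary (set xs)" "alternates q (sort xs)" "\<And>x. x \<in> set xs \<Longrightarrow> x < 2 * c"
  shows "length xs \<le> c"
proof -
  let ?ys = "map (\<lambda>x. x div 2) (sort xs)"
  have "distinct ?ys"
    using strict_sorted_div2_if_alternates[of "sort xs" q] assms(1,2)
    by (simp add: strict_sorted_iff)
  then have "card (set ?ys) = length xs"
    using distinct_card by fastforce
  moreover have "set ?ys \<subseteq> {..<c}"
    using assms(3) by fastforce
  ultimately show ?thesis
    by (metis card_lessThan card_mono finite_lessThan)
qed

section \<open>The complex of signed stable sequences\<close>

definition antipode :: "bool \<times> 'a \<Rightarrow> bool \<times> 'a" where
  "antipode v = (\<not> fst v, snd v)"

lemma antipode_simps [simp]:
  "fst (antipode v) = (\<not> fst v)" "snd (antipode v) = snd v" "antipode (antipode v) = v"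
  "antipode (q, a) = (\<not> q, a)"
  by (simp_all add: antipode_def)

lemma antipode_comp_antipode [simp]: "antipode \<circ> antipode = id"
  by auto

text \<open>A stable \<open>k\<close>-subset \<open>A\<close> of \<open>{1..n}\<close> is given by the sequence \<open>a i = A(i + 1)\<close> for \<open>i \<le> p = k - 1\<close>.
  With \<open>n = m + (\<Sum>i<p. r i)\<close>, the sequence \<open>top_seq m\<close> is the pointwise largest one
  allowed by the gaps, and the last condition in \<open>stable_seq\<close> is the case \<open>s\<^sub>k = 2\<close>, which also
  covers \<open>s\<^sub>k = 1\<close> because it gives fewer sets.\<close>

locale gap_sequence =
  fixes p :: nat and r :: "nat \<Rightarrow> nat"
  assumes gap: "\<And>i. i < p \<Longrightarrow> 2 \<le> r i"
begin

definition top_seq :: "nat \<Rightarrow> nat \<Rightarrow> nat" where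
  "top_seq m i = m + (\<Sum>l<i. r l)"

definition stable_seq :: "nat \<Rightarrow> (nat \<Rightarrow> nat) \<Rightarrow> bool" where
  "stable_seq m a \<longleftrightarrow> 1 \<le> a 0 \<and> (\<forall>i<p. a i + r i \<le> a (Suc i)) \<and>
     a p \<le> top_seq m p \<and> a p + 2 \<le> a 0 + top_seq m p"

definition box :: "nat \<Rightarrow> (bool \<times> (nat \<Rightarrow> nat)) set set" where
  "box m = {\<sigma>. (\<forall>v\<in>\<sigma>. stable_seq m (snd v)) \<and>
     (\<forall>a a'. (True, a) \<in> \<sigma> \<longrightarrow> (False, a') \<in> \<sigma> \<longrightarrow> (\<forall>i\<le>p. \<forall>i'\<le>p. a i \<noteq> a' i'))}"

lemma box_mono: "\<sigma> \<in> box m \<Longrightarrow> \<tau> \<subseteq> \<sigma> \<Longrightarrow> \<tau> \<in> box m"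
  unfolding box_def by blast

lemma box_antipode: "\<sigma> \<in> box m \<Longrightarrow> antipode ` \<sigma> \<in> box m"
  unfolding box_def by (auto simp: antipode_def) metis+

lemma top_seq_Suc [simp]: "top_seq m (Suc i) = top_seq m i + r i"
  by (simp add: top_seq_def)

lemma top_seq_0 [simp]: "top_seq m 0 = m"
  by (simp add: top_seq_def)

lemma top_seq_Suc_left [simp]: "top_seq (Suc m) i = Suc (top_seq m i)"
  by (simp add: top_seq_def)

lemma top_seq_less:
  assumes "i < j" "j \<le> p"
  shows "top_seq m i + 2 \<le> top_seq m j"
  using assms
proof (induction j)
  case (Suc j)
  then show ?case
    using gap[of j] by (cases "i = j") auto
qed simp

lemma top_seq_mono: "i \<le> j \<Longrightarrow> j \<le> p \<Longrightarrow> top_seq m i \<le> top_seq m j"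
  using top_seq_less[of i j m] by (cases "i = j") auto

lemma stable_seq_le_top:
  assumes "stable_seq m a" "i \<le> p"
  shows "a i + top_seq m p \<le> a p + top_seq m i"
  using assms(2)
proof (induction rule: inc_induct)
  case (step i)
  then show ?case
    using assms(1) by (fastforce simp: stable_seq_def)
qed simp

lemma stable_seq_le:
  assumes "stable_seq m a" "i \<le> p"
  shows "a i \<le> top_seq m i"
  using stable_seq_le_top[OF assms] assms(1) by (auto simp: stable_seq_def)

text \<open>When \<open>a 0 = 1\<close>, the cyclic condition costs the last entry one unit, and the
  gaps pass this loss down to all entries.\<close>

lemma stable_seq_less:
  assumes "stable_seq m a" "a 0 = 1" "i \<le> p"
  shows "a i < top_seq m i"
  using stable_seq_le_top[OF assms(1,3)] assms(1,2) by (auto simp: stable_seq_def)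

text \<open>The inclusion of \<open>box m\<close> into \<open>box (Suc m)\<close> is null-homotopic: starting with the largest
  elements, the positive sets without \<open>1\<close> are pushed to \<open>top_seq (Suc m)\<close>, the negative sets to
  \<open>top_seq m\<close>, and the positive sets containing \<open>1\<close>, which must keep it because of cyclic stability,
  to a sequence just below \<open>top_seq m\<close>. Pushing the two signs in turn keeps them disjoint.\<close>

definition push_pos :: "nat \<Rightarrow> nat \<Rightarrow> (nat \<Rightarrow> nat) \<Rightarrow> nat \<Rightarrow> nat" where
  "push_pos m x a i =
    (if a 0 = 1 then (if x < i \<and> i \<le> p then top_seq m i - 1 else a i)
     else (if x \<le> i \<and> i \<le> p then top_seq m i + 1 else a i))"

definition push_neg :: "nat \<Rightarrow> nat \<Rightarrow> (nat \<Rightarrow> nat) \<Rightarrow> nat \<Rightarrow> nat" where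
  "push_neg m y a i = (if y \<le> i \<and> i \<le> p then top_seq m i else a i)"

definition push :: "nat \<Rightarrow> nat \<Rightarrow> nat \<Rightarrow> bool \<times> (nat \<Rightarrow> nat) \<Rightarrow> bool \<times> (nat \<Rightarrow> nat)" where
  "push m x y v = (fst v, if fst v then push_pos m x (snd v) else push_neg m y (snd v))"

lemma push_id: "push m (Suc p) (Suc p) v = v"
proof -
  have "push_pos m (Suc p) a = a" "push_neg m (Suc p) a = a" for a
    by (auto simp: push_pos_def push_neg_def)
  then show ?thesis by (simp add: push_def prod_eq_iff)
qed

lemma stable_push_neg:
  assumes "stable_seq m a" "1 \<le> m"
  shows "stable_seq (Suc m) (push_neg m y a)"
  using assms stable_seq_le[OF assms(1)] unfolding stable_seq_def push_neg_def
  by (auto simp: not_le le_Suc_eq)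

text \<open>The last entry may rise to \<open>top_seq m p + 1\<close> only if the first is at least
  2. A sequence starting with 1 keeps this entry and stops below \<open>top_seq m\<close>.\<close>

lemma stable_push_pos:
  assumes "stable_seq m a" "2 \<le> m"
  shows "stable_seq (Suc m) (push_pos m x a)"
proof (cases "a 0 = 1")
  case True
  have "push_pos m x a i + r i \<le> push_pos m x a (Suc i)" if "i < p" for i
    using True that assms(1) stable_seq_less[OF assms(1) True, of i]
    by (auto simp: push_pos_def stable_seq_def not_less)
  moreover have "push_pos m x a p + 1 \<le> top_seq m p"
    using True stable_seq_less[OF assms(1) True, of p] assms(2)
    by (auto simp: push_pos_def top_seq_def)
  moreover have "push_pos m x a 0 = 1"
    using True by (simp add: push_pos_def)
  ultimately show ?thesis
    by (simp add: stable_seq_def)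
next
  case False
  have "push_pos m x a i + r i \<le> push_pos m x a (Suc i)" if "i < p" for i
    using False that assms(1) stable_seq_le[OF assms(1), of i]
    by (auto simp: push_pos_def stable_seq_def not_le)
  moreover have "push_pos m x a p \<le> Suc (top_seq m p)"
    using False stable_seq_le[OF assms(1), of p]
    by (auto simp: push_pos_def)
  moreover have "2 \<le> push_pos m x a 0"
    using False assms by (auto simp: push_pos_def stable_seq_def)
  ultimately show ?thesis
    by (simp add: stable_seq_def)
qed

text \<open>Pushed entries differ because values of \<open>top_seq m\<close> are at least 2 apart.
  An unpushed entry has index at most that of any pushed entry of the other sign, and so lies below
  it.\<close>

lemma push_pos_neq_push_neg:
  assumes "stable_seq m a" "stable_seq m a'"
    and disj: "\<And>i i'. i \<le> p \<Longrightarrow> i' \<le> p \<Longrightarrow> a i \<noteq> a' i'"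
    and xy: "x \<le> y" "y \<le> Suc x" and i: "i \<le> p" "i' \<le> p"
  shows "push_pos m x a i \<noteq> push_neg m y a' i'"
proof -
  have le: "a i \<le> top_seq m i" "a' i' \<le> top_seq m i'"
    using assms stable_seq_le by auto
  have less: "a i < top_seq m i" if "a 0 = 1"
    using assms stable_seq_less that by auto
  consider "i < i'" | "i = i'" | "i' < i" by linarith
  then show ?thesis
  proof cases
    case 1
    have "top_seq m i + 2 \<le> top_seq m i'"
      using top_seq_less 1 i by blast
    then show ?thesis
      using 1 le less disj[OF i] xy i by (auto simp: push_pos_def push_neg_def)
  next
    case 2
    then show ?thesis
      using le less disj[OF i] xy i by (auto simp: push_pos_def push_neg_def)
  next
    case 3
    have "top_seq m i' + 2 \<le> top_seq m i"
      using top_seq_less 3 i by blast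
    then show ?thesis
      using 3 le less disj[OF i] xy i by (auto simp: push_pos_def push_neg_def)
  qed
qed

lemma push_contiguous:
  assumes "\<sigma> \<in> box m" "2 \<le> m"
    and xy: "x \<le> y" "x \<le> y'" "x' \<le> y" "x' \<le> y'" "y \<le> Suc x" "y \<le> Suc x'" "y' \<le> Suc x" "y' \<le> Suc x'"
  shows "push m x y ` \<sigma> \<union> push m x' y' ` \<sigma> \<in> box (Suc m)"
proof -
  have stable: "stable_seq m (snd v)" if "v \<in> \<sigma>" for v
    using that assms(1) by (auto simp: box_def)
  have disj: "a i \<noteq> a' i'" if "(True, a) \<in> \<sigma>" "(False, a') \<in> \<sigma>" "i \<le> p" "i' \<le> p" for a a' i i'
    using that assms(1) unfolding box_def by blast
  have pos: "\<exists>a. (True, a) \<in> \<sigma> \<and> (b = push_pos m x a \<or> b = push_pos m x' a)"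
    if "(True, b) \<in> push m x y ` \<sigma> \<union> push m x' y' ` \<sigma>" for b
    using that by (auto simp: push_def split: if_splits)
  have neg: "\<exists>a. (False, a) \<in> \<sigma> \<and> (b = push_neg m y a \<or> b = push_neg m y' a)"
    if "(False, b) \<in> push m x y ` \<sigma> \<union> push m x' y' ` \<sigma>" for b
    using that by (auto simp: push_def split: if_splits)
  show ?thesis
    unfolding box_def
  proof (intro CollectI conjI ballI allI impI)
    fix v assume "v \<in> push m x y ` \<sigma> \<union> push m x' y' ` \<sigma>"
    then show "stable_seq (Suc m) (snd v)"
      using stable stable_push_pos stable_push_neg assms(2) by (auto simp: push_def)
  next
    fix b b' i i'
    assume "(True, b) \<in> push m x y ` \<sigma> \<union> push m x' y' ` \<sigma>"
      and "(False, b') \<in> push m x y ` \<sigma> \<union> push m x' y' ` \<sigma>" and i: "i \<le> p" "i' \<le> p"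
    then obtain a a' where a: "(True, a) \<in> \<sigma>" "b = push_pos m x a \<or> b = push_pos m x' a"
      and a': "(False, a') \<in> \<sigma>" "b' = push_neg m y a' \<or> b' = push_neg m y' a'"
      using pos neg by blast
    have *: "push_pos m u a i \<noteq> push_neg m w a' i'" if "u \<le> w" "w \<le> Suc u" for u w
      using stable[OF a(1)] stable[OF a'(1)] disj[OF a(1) a'(1)] that i
      by (intro push_pos_neq_push_neg) auto
    show "b i \<noteq> b' i'"
      using a(2) a'(2) *[of x y] *[of x y'] *[of x' y] *[of x' y'] xy by auto
  qed
qed

text \<open>All pushed negative sequences agree with \<open>top_seq m\<close> up to
  \<open>p\<close>; positive entries are off by one from it or equal to a kept 1, which is less than
  \<open>m\<close>.\<close>

lemma push_cone:
  assumes "\<sigma> \<in> box m" "2 \<le> m"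
  shows "insert (False, top_seq m) (push m 0 0 ` \<sigma>) \<in> box (Suc m)"
proof -
  have stable: "stable_seq m (snd v)" if "v \<in> \<sigma>" for v
    using that assms(1) by (auto simp: box_def)
  have img: "push m 0 0 ` \<sigma> \<in> box (Suc m)"
    using push_contiguous[OF assms, of 0 0 0 0] by simp
  have "stable_seq (Suc m) (top_seq m)"
    using assms(2) by (simp add: stable_seq_def)
  moreover have "push_pos m 0 a i \<noteq> top_seq m i'"
    if "(True, a) \<in> \<sigma>" "i \<le> p" "i' \<le> p" for a i i'
    using that stable[OF that(1)] top_seq_less[of i i' m] top_seq_less[of i' i m]
      top_seq_mono[of 0 i' m] assms(2)
    by (cases i i' rule: linorder_cases) (auto simp: push_pos_def)
  ultimately show ?thesis
    using img unfolding box_def by (auto simp: push_def split: if_splits)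
qed

lemma box_inclusion_nullhomotopic:
  assumes m: "2 \<le> m"
    and cocycle: "\<And>xs. set xs \<in> box (Suc m) \<Longrightarrow> length xs = Suc d \<Longrightarrow> coboundary a xs = 0"
  shows "\<exists>\<beta>. \<forall>xs. set xs \<in> box m \<longrightarrow> length xs = d \<longrightarrow> a xs = coboundary \<beta> xs"
proof -
  define cohom :: "((bool \<times> (nat \<Rightarrow> nat)) \<Rightarrow> (bool \<times> (nat \<Rightarrow> nat))) \<Rightarrow> _ \<Rightarrow> bool" where
    "cohom f g \<longleftrightarrow> (\<exists>\<beta>. \<forall>xs. set xs \<in> box m \<longrightarrow> length xs = d \<longrightarrow>
       a (map f xs) + a (map g xs) = coboundary \<beta> xs)" for f g
  have trans: "cohom f h" if fg: "cohom f g" and gh: "cohom g h" for f g h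
  proof -
    obtain \<beta> where \<beta>: "\<And>xs. set xs \<in> box m \<Longrightarrow> length xs = d \<Longrightarrow>
        a (map f xs) + a (map g xs) = coboundary \<beta> xs"
      using fg unfolding cohom_def by blast
    obtain \<beta>' where \<beta>': "\<And>xs. set xs \<in> box m \<Longrightarrow> length xs = d \<Longrightarrow>
        a (map g xs) + a (map h xs) = coboundary \<beta>' xs"
      using gh unfolding cohom_def by blast
    have "a (map f xs) + a (map h xs) = coboundary (\<lambda>ys. \<beta> ys + \<beta>' ys) xs"
      if "set xs \<in> box m" "length xs = d" for xs
      by (simp add: coboundary_add ac_simps flip: \<beta>[OF that] \<beta>'[OF that])
    then show ?thesis unfolding cohom_def by blast
  qed
  have contig: "cohom (push m x y) (push m x' y')"
    if "x \<le> y" "x \<le> y'" "x' \<le> y" "x' \<le> y'" "y \<le> Suc x" "y \<le> Suc x'" "y' \<le> Suc x" "y' \<le> Suc x'"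
    for x y x' y'
    unfolding cohom_def
    by (rule contiguous_cohomologous[where Y = "box (Suc m)"])
      (use push_contiguous[OF _ m that] box_mono cocycle in blast)+
  have "cohom id (push m x x)" if "x \<le> Suc p" for x
    using that
  proof (induction rule: inc_induct)
    case base
    have "push m (Suc p) (Suc p) = id"
      using push_id by auto
    then show ?case
      using contig[of "Suc p" "Suc p" "Suc p" "Suc p"] by (simp del: id_apply)
  next
    case (step x)
    \<comment> \<open>The positive sets move first, so the negative parameter is always equal to the
      positive one or one larger.\<close>
    have "cohom (push m (Suc x) (Suc x)) (push m x (Suc x))"
      by (rule contig) auto
    moreover have "cohom (push m x (Suc x)) (push m x x)"
      by (rule contig) auto
    ultimately show ?case
      using trans step.IH by blast
  qed
  then obtain \<beta> where \<beta>: "\<And>xs. set xs \<in> box m \<Longrightarrow> length xs = d \<Longrightarrow>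
      a xs + a (map (push m 0 0) xs) = coboundary \<beta> xs"
    unfolding cohom_def by (metis le0 list.map_id)
  \<comment> \<open>The cone operator with apex \<open>(False, top_seq m)\<close>; the cocycle
    condition on the cone makes the pushed \<open>a\<close> a coboundary.\<close>
  define \<gamma> where "\<gamma> = (\<lambda>ys. a ((False, top_seq m) # ys))"
  have "a xs = coboundary (\<lambda>ys. \<beta> ys + \<gamma> (map (push m 0 0) ys)) xs"
    if xs: "set xs \<in> box m" "length xs = d" for xs
  proof -
    have "coboundary a ((False, top_seq m) # map (push m 0 0) xs) = 0"
      using push_cone[OF xs(1) m] xs(2) by (intro cocycle) auto
    then have "a (map (push m 0 0) xs) = coboundary \<gamma> (map (push m 0 0) xs)"
      by (simp add: \<gamma>_def bit_add_eq_0)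
    then show ?thesis
      by (simp add: coboundary_add coboundary_map ac_simps flip: \<beta>[OF xs])
  qed
  then show ?thesis by blast
qed

section \<open>Induction on \<open>m\<close>\<close>

text \<open>The condition on vertices is \<delta>a = a + \<nu>a in length 1 with \<open>a []\<close>
  normalised to 1.\<close>

lemma no_short_index_cochain:
  fixes a :: "(bool \<times> (nat \<Rightarrow> nat)) list \<Rightarrow> bit"
  assumes "2 \<le> m"
    and "\<And>v. {v} \<in> box m \<Longrightarrow> a [v] + a [antipode v] = 1"
    and "\<And>xs. set xs \<in> box m \<Longrightarrow> 2 \<le> length xs \<Longrightarrow> length xs \<le> m \<Longrightarrow>
           coboundary a xs = a xs + a (map antipode xs)"
    and "\<And>xs. set xs \<in> box m \<Longrightarrow> length xs = m \<Longrightarrow> a xs = 0"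
  shows False
  using assms
proof (induction m arbitrary: a rule: dec_induct)
  case base
  have stable: "stable_seq 2 (top_seq 2)" "stable_seq 2 (top_seq 1)"
    by (auto simp: stable_seq_def numeral_2_eq_2)
  have "top_seq 1 i \<noteq> top_seq 2 i'" if "i \<le> p" "i' \<le> p" for i i'
    using that top_seq_less[of i i' 1] top_seq_less[of i' i 1]
    by (cases i i' rule: linorder_cases) (auto simp: numeral_2_eq_2)
  \<comment> \<open>The path \<open>(True, top_seq 1)\<close>, \<open>(False, top_seq 2)\<close>,
    \<open>(False, top_seq 1)\<close> joins a vertex to its antipode, while vanishing on edges makes
    \<open>a\<close> constant along it.\<close>
  then have edge: "{(True, top_seq 1), (False, top_seq 2)} \<in> box 2"
    "{(True, top_seq 2), (False, top_seq 1)} \<in> box 2"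
    "{(False, top_seq 2), (False, top_seq 1)} \<in> box 2"
    using stable unfolding box_def by (auto dest: sym)
  have edge_eq: "a [u] = a [v]" if "{u, v} \<in> box 2" for u v
  proof -
    have "antipode ` {u, v} \<in> box 2"
      using that by (rule box_antipode)
    then have "a [u, v] = 0" "a (map antipode [u, v]) = 0"
      using base(3) that by (auto simp: insert_commute)
    then have "coboundary a [u, v] = 0"
      using base(2)[of "[u, v]"] that by simp
    then show ?thesis by (simp add: bit_add_eq_0)
  qed
  have "{(True, top_seq 1)} \<in> box 2"
    using edge(1) by (rule box_mono) auto
  then have "a [(True, top_seq 1)] + a [(False, top_seq 1)] = 1"
    using base(1) by fastforce
  moreover have "a [(True, top_seq 1)] = a [(False, top_seq 1)]"
    using edge_eq[OF edge(1)] edge_eq[OF edge(3)] by simp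
  ultimately show False by simp
next
  case (step m)
  have sub: "\<sigma> \<in> box (Suc m)" if "\<sigma> \<in> box m" for \<sigma>
    using that unfolding box_def by (auto simp: stable_seq_def)
  have "coboundary a xs = 0" if "set xs \<in> box (Suc m)" "length xs = Suc m" for xs
    using that step.hyps step.prems(2)[of xs] step.prems(3)[of xs]
      step.prems(3)[of "map antipode xs"] box_antipode by simp
  from box_inclusion_nullhomotopic[OF step.hyps(1) this]
  obtain \<beta> where \<beta>: "\<And>xs. set xs \<in> box m \<Longrightarrow> length xs = m \<Longrightarrow> a xs = coboundary \<beta> xs"
    by blast
  \<comment> \<open>In length \<open>m\<close>, \<delta>(a + \<beta> + \<nu>\<beta>) = (a + \<nu>a)
    + a + \<nu>a = 0, so the top part can be set to 0. One length lower, the antipodally symmetric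
    correction cancels from a + \<nu>a.\<close>
  define a' where "a' xs = (if length xs = m then 0 else if Suc (length xs) = m
      then a xs + (\<beta> xs + \<beta> (map antipode xs)) else a xs)" for xs
  show False
  proof (rule step.IH)
    fix v assume "{v} \<in> box m"
    then have "a [v] + a [antipode v] = 1"
      using sub step.prems(1) by blast
    then show "a' [v] + a' [antipode v] = 1"
      using step.hyps(1) by (auto simp: a'_def ac_simps)
  next
    fix xs assume xs: "set xs \<in> box m" "2 \<le> length xs" "length xs \<le> m"
    have co: "coboundary a xs = a xs + a (map antipode xs)"
      using step.prems(2)[OF sub[OF xs(1)]] xs by simp
    show "coboundary a' xs = a' xs + a' (map antipode xs)"
    proof (cases "length xs = m")
      case True
      have "coboundary a' xs = coboundary (\<lambda>ys. a ys + (\<beta> ys + \<beta> (map antipode ys))) xs"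
        using True by (intro coboundary_cong) (auto simp: a'_def)
      also have "\<dots> = coboundary a xs + (coboundary \<beta> xs + coboundary \<beta> (map antipode xs))"
        by (simp add: coboundary_add coboundary_map)
      also have "\<dots> = 0"
        using co \<beta>[of xs] \<beta>[of "map antipode xs"] True xs(1) box_antipode[OF xs(1)]
        by (simp add: ac_simps)
      finally show ?thesis using True by (simp add: a'_def)
    next
      case False
      have "coboundary a' xs = coboundary a xs"
        using False xs by (intro coboundary_cong) (auto simp: a'_def)
      then show ?thesis
        using co False by (simp add: a'_def ac_simps)
    qed
  qed (simp add: a'_def)
qed

section \<open>From colourings to alternating cochains\<close>

lemma no_coloring:
  fixes g :: "nat set \<Rightarrow> nat"
  assumes "2 \<le> m" "c < m"
    and g_less: "\<And>a. stable_seq m a \<Longrightarrow> g (a ` {..p}) < c"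
    and g_neq: "\<And>a a'. stable_seq m a \<Longrightarrow> stable_seq m a' \<Longrightarrow> a ` {..p} \<inter> a' ` {..p} = {} \<Longrightarrow>
      g (a ` {..p}) \<noteq> g (a' ` {..p})"
  shows False
proof -
  define code where "code v = 2 * g (snd v ` {..p}) + of_bool (fst v)" for v :: "bool \<times> (nat \<Rightarrow> nat)"
  define a :: "_ \<Rightarrow> bit" where "a xs = of_bool (alternates True (sort (map code xs)))" for xs
  have code_antipode: "code (antipode v) = flip (code v)" for v
    by (simp add: code_def flip_def)
  have code_div: "code v div 2 = g (snd v ` {..p})" for v
    by (simp add: code_def)
  have neq: "code u div 2 \<noteq> code v div 2"
    if "set xs \<in> box m" "u \<in> set xs" "v \<in> set xs" "fst u" "\<not> fst v" for xs u v
  proof -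
    obtain b b' where uv: "u = (True, b)" "v = (False, b')"
      using \<open>fst u\<close> \<open>\<not> fst v\<close> by (cases u; cases v) auto
    then have "stable_seq m b" "stable_seq m b'" "b ` {..p} \<inter> b' ` {..p} = {}"
      using that unfolding box_def by fastforce+
    then show ?thesis
      using g_neq uv by (simp add: code_div)
  qed
  \<comment> \<open>Equal colours on opposite signs would give disjoint sets of the same
    colour.\<close>
  have compl: "no_complementary (set (map code xs))" if "set xs \<in> box m" for xs
    unfolding no_complementary_def
  proof (rule inj_onI)
    fix x y assume "x \<in> set (map code xs)" "y \<in> set (map code xs)" and eq: "x div 2 = y div 2"
    then obtain u v where uv: "u \<in> set xs" "v \<in> set xs" "x = code u" "y = code v"
      by auto
    then have "fst u = fst v"
      using neq[OF that, of u v] neq[OF that, of v u] eq by auto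
    then show "x = y"
      using eq uv by (simp add: code_def)
  qed
  show False
  proof (rule no_short_index_cochain[OF \<open>2 \<le> m\<close>])
    show "a [v] + a [antipode v] = 1" for v
      by (simp add: a_def code_antipode flip_def)
  next
    fix xs assume "set xs \<in> box m"
    have "coboundary a xs = coboundary (\<lambda>ys. of_bool (alternates True (sort ys))) (map code xs)"
      by (simp add: a_def[abs_def] coboundary_map[of "\<lambda>ys. of_bool (alternates True (sort ys))" code])
    also have "\<dots> = a xs + a (map antipode xs)"
      using coboundary_alternates_sort[OF compl[OF \<open>set xs \<in> box m\<close>]]
      by (simp add: a_def comp_def code_antipode)
    finally show "coboundary a xs = a xs + a (map antipode xs)" .
  next
    fix xs assume xs: "set xs \<in> box m" "length xs = m"
    have "x < 2 * c" if x: "x \<in> set (map code xs)" for x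
    proof -
      obtain v where "v \<in> set xs" "x = code v"
        using x by auto
      then have "stable_seq m (snd v)"
        using xs(1) by (auto simp: box_def)
      then show ?thesis
        using g_less[of "snd v"] \<open>x = code v\<close> by (simp add: code_def)
    qed
    then have "\<not> alternates True (sort (map code xs))"
      using alternates_length_le[OF compl[OF xs(1)], of True c] xs(2) \<open>c < m\<close> by fastforce
    then show "a xs = 0"
      by (simp add: a_def)
  qed
qed

section \<open>Stable sequences as subsets, and the chromatic number\<close>

lemma stable_seq_strict_mono:
  assumes "stable_seq m a" "i < j" "j \<le> p"
  shows "a i < a j"
  using assms(2,3)
proof (induction j)
  case (Suc j)
  have "2 \<le> r j" "a j + r j \<le> a (Suc j)"
    using assms(1) Suc.prems gap[of j] by (auto simp: stable_seq_def)
  then have "a j < a (Suc j)"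
    by linarith
  then show ?case
    using Suc by (cases "i = j") auto
qed simp

lemma nth_elem_stable_seq:
  assumes "stable_seq m a" "1 \<le> j" "j \<le> Suc p"
  shows "nth_elem (a ` {..p}) j = a (j - 1)"
proof -
  have "sorted_wrt (<) (map a [0..<Suc p])"
    using stable_seq_strict_mono[OF assms(1)] by (auto simp: sorted_wrt_iff_nth_less simp del: upt_Suc)
  then have "sorted_list_of_set (a ` {..p}) = map a [0..<Suc p]"
    by (intro strict_sorted_equal) (auto simp: atLeast0LessThan lessThan_Suc_atMost simp del: upt_Suc)
  then show ?thesis
    using assms(2,3) by (simp add: nth_elem_def del: upt_Suc)
qed

lemma card_stable_seq:
  assumes "stable_seq m a"
  shows "card (a ` {..p}) = Suc p"
proof -
  have "inj_on a {..p}"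
    by (rule linorder_inj_onI) (use stable_seq_strict_mono[OF assms] in \<open>auto simp: less_imp_neq\<close>)
  then show ?thesis by (simp add: card_image)
qed

end

lemma nth_elem_in:
  assumes "finite A" "1 \<le> j" "j \<le> card A"
  shows "nth_elem A j \<in> A"
proof -
  have "sorted_list_of_set A ! (j - 1) \<in> set (sorted_list_of_set A)"
    using assms by (intro nth_mem) simp
  then show ?thesis
    using assms(1) by (simp add: nth_elem_def)
qed

text \<open>The gaps add up to at most A(k) - A(1), and A(k) is at most \<open>n\<close>. This
  bounds the number of colours used by the smallest element.\<close>

lemma stable_set_first_le:
  assumes "stable_set n k s A" "1 \<le> k"
  shows "int (nth_elem A 1) + (\<Sum>i = 1..k - 1. s i) \<le> int n"
proof -
  have "int (nth_elem A 1) + (\<Sum>i = 1..j. s i) \<le> int (nth_elem A (Suc j))" if "j \<le> k - 1" for j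
    using that
  proof (induction j)
    case (Suc j)
    then have "s (Suc j) \<le> int (nth_elem A (Suc (Suc j))) - int (nth_elem A (Suc j))"
      using assms(1) by (auto simp: stable_set_def dest: spec[of _ "Suc j"])
    then show ?case
      using Suc by simp
  qed simp
  from this[of "k - 1"] have "int (nth_elem A 1) + (\<Sum>i = 1..k - 1. s i) \<le> int (nth_elem A k)"
    using assms(2) by simp
  moreover have "nth_elem A k \<in> A"
    using nth_elem_in[of A k] assms by (auto simp: stable_set_def intro: finite_subset)
  ultimately show ?thesis
    using assms(1) by (fastforce simp: stable_set_def)
qed

theorem theorem3:
  fixes n k :: nat and s :: "nat \<Rightarrow> int"
  assumes "n \<ge> 1" and "k \<ge> 2"
    and "\<And>i. 1 \<le> i \<Longrightarrow> i < k \<Longrightarrow> s i \<ge> 2"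
    and "s k \<in> {1, 2}"
    and "int n \<ge> (\<Sum>i = 1..k - 1. s i) + 2"
  shows "int (chromatic_number (stable_kneser_graph n k s)) = int n - (\<Sum>i = 1..k - 1. s i)"
proof -
  obtain p where k: "k = Suc p"
    using \<open>k \<ge> 2\<close> by (cases k) auto
  define r where "r i = nat (s (Suc i))" for i
  have r: "int (r i) = s (Suc i)" "2 \<le> r i" if "i < p" for i
    using assms(3)[of "Suc i"] that by (auto simp: r_def k)
  interpret gap_sequence p r
    by standard (rule r)
  have sum_r: "(\<Sum>i = 1..k - 1. s i) = int (\<Sum>l<p. r l)"
    using r(1) by (simp add: k sum.atLeast1_atMost_eq)
  define m where "m = n - (\<Sum>l<p. r l)"
  have m: "2 \<le> m" "int m = int n - (\<Sum>i = 1..k - 1. s i)"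
  proof -
    have "(\<Sum>l<p. r l) + 2 \<le> n"
      using assms(5) unfolding sum_r by linarith
    then show "2 \<le> m" "int m = int n - (\<Sum>i = 1..k - 1. s i)"
      unfolding m_def sum_r by (simp_all only: of_nat_diff)
  qed
  have top: "top_seq m p = n"
    using m(2) unfolding sum_r top_seq_def by linarith
  have stable: "stable_set n k s (a ` {..p})" if a: "stable_seq m a" for a
  proof -
    have "1 \<le> a i" "a i \<le> n" if "i \<le> p" for i
      using stable_seq_strict_mono[OF a, of 0 i] stable_seq_strict_mono[OF a, of i p] a that top
      by (cases "i = 0"; cases "i = p"; simp add: stable_seq_def)+
    moreover have "s j \<le> int (a j) - int (a (j - 1))" if "1 \<le> j" "j \<le> p" for j
    proof -
      have "a (j - 1) + r (j - 1) \<le> a j"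
        using a that unfolding stable_seq_def by (metis Suc_diff_1 less_eq_Suc_le One_nat_def)
      moreover have "int (r (j - 1)) = s j"
        using r(1)[of "j - 1"] that by simp
      ultimately show ?thesis
        by linarith
    qed
    \<comment> \<open>The cyclic gap 2 in \<open>stable_seq\<close> suffices for both values of
      \<open>s k\<close>.\<close>
    moreover have "int (a p) - int (a 0) \<le> int n - s k"
      using a top assms(4) by (auto simp: stable_seq_def)
    ultimately show ?thesis
      using a card_stable_seq[OF a] by (auto simp: stable_set_def nth_elem_stable_seq[OF a] k)
  qed
  \<comment> \<open>Sets with the same smallest element meet; subtracting 1 makes the colours start
    at 0.\<close>
  have "proper_coloring (stable_kneser_graph n k s) m (\<lambda>A. nth_elem A 1 - 1)"
  proof -
    have first: "nth_elem A 1 \<in> A" "1 \<le> nth_elem A 1" "nth_elem A 1 \<le> m"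
      if A: "stable_set n k s A" for A
    proof -
      show *: "nth_elem A 1 \<in> A"
        using nth_elem_in[of A 1] A \<open>k \<ge> 2\<close> by (auto simp: stable_set_def intro: finite_subset)
      then show "1 \<le> nth_elem A 1"
        using A by (fastforce simp: stable_set_def)
      show "nth_elem A 1 \<le> m"
        using stable_set_first_le[OF A] m(2) \<open>k \<ge> 2\<close> by simp
    qed
    have "nth_elem A 1 - 1 \<noteq> nth_elem B 1 - 1"
      if "stable_set n k s A" "stable_set n k s B" "A \<inter> B = {}" for A B
    proof
      assume "nth_elem A 1 - 1 = nth_elem B 1 - 1"
      then have "nth_elem A 1 = nth_elem B 1"
        using first(2)[OF that(1)] first(2)[OF that(2)] by simp
      then show False
        using first(1)[OF that(1)] first(1)[OF that(2)] that(3) by auto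
    qed
    then show ?thesis
      using first(2,3) by (fastforce simp: proper_coloring_def stable_kneser_graph_def)
  qed
  moreover have "m \<le> c" if g: "proper_coloring (stable_kneser_graph n k s) c g" for c g
  proof (rule ccontr)
    assume "\<not> m \<le> c"
    then show False
      using g stable by (intro no_coloring[OF m(1), of c g])
        (auto simp: proper_coloring_def stable_kneser_graph_def)
  qed
  ultimately have "chromatic_number (stable_kneser_graph n k s) = m"
    unfolding chromatic_number_def by (intro Least_equality) auto
  then show ?thesis
    using m(2) by simp
qed

end
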